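(* Let $\mathfrak{A}$ be a (not necessarily unital) $C^*$-algebra and let $T \colon \mathfrak{A} \to \mathfrak{A}$ be a positive surjective linear isometry. Then the inverse $T^{-1}$ is positive.
   Context: A linear operator $T$ on a $C^*$-algebra $\mathfrak{A}$ is positive if it maps the positive cone $\mathfrak{A}_+$ into $\mathfrak{A}_+$. *)

theory Defs
  imports Complex_Main
begin

text \<open>
  Complex \<open>C\<^sup>*\<close>-algebras, not assumed unital. Since \<^class>\<open>real_normed_algebra\<close> and \<^class>\<open>banach\<close>
  speak about real scalars only, complex scalar multiplication is added as a parameter
  extending \<^const>\<open>scaleR\<close>.
\<close>

class cstar_algebra = real_normed_algebra + banach +
  fixes scaleC :: "complex \<Rightarrow> 'a \<Rightarrow> 'a" (infixr "*\<^sub>C" 75)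
    and star :: "'a \<Rightarrow> 'a"
  assumes scaleC_add_right: "c *\<^sub>C (x + y) = c *\<^sub>C x + c *\<^sub>C y"
    and scaleC_add_left: "(c + d) *\<^sub>C x = c *\<^sub>C x + d *\<^sub>C x"
    and scaleC_scaleC: "c *\<^sub>C (d *\<^sub>C x) = (c * d) *\<^sub>C x"
    and scaleC_of_real: "complex_of_real r *\<^sub>C x = r *\<^sub>R x"
    and mult_scaleC_left: "(c *\<^sub>C x) * y = c *\<^sub>C (x * y)"
    and mult_scaleC_right: "x * (c *\<^sub>C y) = c *\<^sub>C (x * y)"
    and norm_scaleC: "norm (c *\<^sub>C x) = cmod c * norm x"
    and star_star: "star (star x) = x"
    and star_add: "star (x + y) = star x + star y"
    and star_scaleC: "star (c *\<^sub>C x) = cnj c *\<^sub>C star x"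
    and star_mult: "star (x * y) = star y * star x"
    and cstar_identity: "norm (star x * x) = (norm x)\<^sup>2"

instantiation complex :: cstar_algebra
begin
definition scaleC_complex :: "complex \<Rightarrow> complex \<Rightarrow> complex" where "scaleC_complex = (*)"
definition star_complex :: "complex \<Rightarrow> complex" where "star_complex = cnj"
instance
  by standard
    (simp_all add: scaleC_complex_def star_complex_def algebra_simps norm_mult
      scaleR_conv_of_real power2_eq_square)
end

lemma vector_space_scaleC: "vector_space (scaleC :: complex \<Rightarrow> 'a::cstar_algebra \<Rightarrow> 'a)"
proof
  fix x :: 'a
  show "1 *\<^sub>C x = x"
    using scaleC_of_real[of 1 x] by simp
qed (simp_all add: scaleC_add_right scaleC_add_left scaleC_scaleC)

text \<open>
  Multiplication in the unitization, where \<open>(x, \<alpha>)\<close> stands for \<open>x + \<alpha>1\<close>; its unit is \<open>(0, 1)\<close>.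
\<close>

definition unitization_mult ::
  "'a::cstar_algebra \<times> complex \<Rightarrow> 'a \<times> complex \<Rightarrow> 'a \<times> complex" where
  "unitization_mult u v =
    (fst u * fst v + snd v *\<^sub>C fst u + snd u *\<^sub>C fst v, snd u * snd v)"

text \<open>
  The spectrum is always taken in the unitization, whether or not the algebra has a unit.
  For a unital algebra this merely adjoins \<open>0\<close> to the spectrum in the algebra itself
  (see \<open>spectrum_unital\<close>), so it does not affect positivity.
\<close>

definition spectrum :: "'a::cstar_algebra \<Rightarrow> complex set" where
  "spectrum a = {z. \<not> (\<exists>u. unitization_mult (a, - z) u = (0, 1) \<and>
                            unitization_mult u (a, - z) = (0, 1))}"

lemma spectrum_unital:
  fixes a e :: "'a::cstar_algebra"
  assumes e: "\<And>x. e * x = x" "\<And>x. x * e = x"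
  shows "spectrum a =
    insert 0 {z. \<not> (\<exists>b. (a - z *\<^sub>C e) * b = e \<and> b * (a - z *\<^sub>C e) = e)}"
proof -
  interpret vector_space "scaleC :: complex \<Rightarrow> 'a \<Rightarrow> 'a"
    by (rule vector_space_scaleC)
  note simps = unitization_mult_def algebra_simps mult_scaleC_left mult_scaleC_right e
  have "(\<exists>u. unitization_mult (a, - z) u = (0, 1) \<and> unitization_mult u (a, - z) = (0, 1)) \<longleftrightarrow>
        (\<exists>b. (a - z *\<^sub>C e) * b = e \<and> b * (a - z *\<^sub>C e) = e)" (is "?L \<longleftrightarrow> ?R") if z: "z \<noteq> 0" for z
  proof
    assume ?L
    then obtain y c where yc: "unitization_mult (a, - z) (y, c) = (0, 1)"
      "unitization_mult (y, c) (a, - z) = (0, 1)" by (metis surj_pair)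
    have zc: "z * c = -1" using yc by (simp add: unitization_mult_def minus_equation_iff)
    have 1: "a * y + c *\<^sub>C a - z *\<^sub>C y = 0" "y * a + c *\<^sub>C a - z *\<^sub>C y = 0"
      using yc by (simp_all add: unitization_mult_def algebra_simps)
    have "(a - z *\<^sub>C e) * (y + c *\<^sub>C e) = (a * y + c *\<^sub>C a - z *\<^sub>C y) - (z * c) *\<^sub>C e"
      by (simp add: simps)
    moreover have "(y + c *\<^sub>C e) * (a - z *\<^sub>C e) = (y * a + c *\<^sub>C a - z *\<^sub>C y) - (z * c) *\<^sub>C e"
      by (simp add: simps)
    ultimately show ?R using 1 zc by (intro exI[of _ "y + c *\<^sub>C e"]) simp
  next
    assume ?R
    then obtain b where b: "(a - z *\<^sub>C e) * b = e" "b * (a - z *\<^sub>C e) = e" by blast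
    have "a * b = e + z *\<^sub>C b" "b * a = e + z *\<^sub>C b"
      using b by (simp_all add: simps)
    then show ?L using z
      by (intro exI[of _ "(b + inverse z *\<^sub>C e, - inverse z)"]) (simp add: simps)
  qed
  then have "z \<in> spectrum a \<longleftrightarrow>
      \<not> (\<exists>b. (a - z *\<^sub>C e) * b = e \<and> b * (a - z *\<^sub>C e) = e)" if "z \<noteq> 0" for z
    unfolding spectrum_def mem_Collect_eq using that by metis
  moreover have "0 \<in> spectrum a"
    by (simp add: spectrum_def unitization_mult_def)
  ultimately show ?thesis
    unfolding set_eq_iff insert_iff mem_Collect_eq by metis
qed

definition positive_cone :: "'a::cstar_algebra set" where
  "positive_cone = {a. star a = a \<and> spectrum a \<subseteq> complex_of_real ` {0..}}"

definition positive_operator :: "('a::cstar_algebra \<Rightarrow> 'a) \<Rightarrow> bool" where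
  "positive_operator T \<longleftrightarrow> T ` positive_cone \<subseteq> positive_cone"

end

theory Submission
  imports Defs "HOL-Analysis.Operator_Norm"
begin

text \<open>
  Let \<open>T a \<ge> 0\<close>. As \<open>T\<close> is positive it commutes with the involution, so \<open>a\<close> is self-adjoint and
  \<open>a = p - q\<close> with \<open>p, q \<ge> 0\<close> and \<open>p q = 0\<close>. If \<open>q \<noteq> 0\<close>, put \<open>t = norm p / norm q\<close>. Orthogonality gives
  \<open>norm (p + t q) = norm p\<close>, whereas \<open>0 \<le> T q \<le> T p\<close> gives
  \<open>norm (p + t q) = norm (T p + t T q) \<ge> (1 + t) norm (T q) = norm q + norm p\<close>, a contradiction.

  The order-theoretic facts are obtained without functional calculus or the spectral radius
  formula. In the unitization, \<open>x = x\<^sup>*\<close> has spectrum in \<open>[0, \<infinity>)\<close> iff \<open>norm (r - x) \<le> r\<close> for some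
  \<open>r\<close>; such \<open>x\<close> have square roots, and \<open>norm x - x\<close> is not invertible for them.
\<close>

section \<open>Elementary properties of the involution\<close>

interpretation scaleC: vector_space "scaleC :: complex \<Rightarrow> 'a::cstar_algebra \<Rightarrow> 'a"
  by (rule vector_space_scaleC)

lemma star_zero [simp]: "star (0::'a::cstar_algebra) = 0"
  using star_add[of "0::'a" 0] by simp

lemma star_minus: "star (- x) = - star (x::'a::cstar_algebra)"
  using star_add[of x "- x"] by (simp add: eq_neg_iff_add_eq_0 add.commute)

lemma star_diff: "star (x - y) = star x - star (y::'a::cstar_algebra)"
  using star_add[of x "- y"] by (simp add: star_minus)

lemma star_scaleR: "star (r *\<^sub>R x) = r *\<^sub>R star (x::'a::cstar_algebra)"
  by (metis star_scaleC scaleC_of_real complex_cnj_complex_of_real)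

lemma star_one [simp]: "star (1::'a::{cstar_algebra,real_normed_algebra_1}) = 1"
  by (metis star_mult star_star mult_1 mult_1_right)

lemma star_of_real [simp]: "star (of_real r :: 'a::{cstar_algebra,real_normed_algebra_1}) = of_real r"
  by (simp add: of_real_def star_scaleR)

text \<open>The C*-identity and submultiplicativity bound the square of \<open>norm y\<close> by
  \<open>norm (star y) * norm y\<close>; cancel, then apply this to both \<open>x\<close> and
  \<open>star x\<close>.\<close>

lemma norm_star [simp]: "norm (star x) = norm (x::'a::cstar_algebra)"
proof -
  have le: "norm y \<le> norm (star y)" for y :: 'a
  proof (cases "y = 0")
    case False
    have "norm y * norm y \<le> norm (star y) * norm y"
      using norm_mult_ineq[of "star y" y] by (simp add: cstar_identity power2_eq_square)
    then show ?thesis using False by simp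
  qed simp
  show ?thesis using le[of x] le[of "star x"] by (simp add: star_star)
qed

lemma bounded_linear_star: "bounded_linear (star :: 'a::cstar_algebra \<Rightarrow> 'a)"
  by (rule bounded_linear_intro[of _ 1]) (simp_all add: star_add star_scaleR)

lemma norm_square_selfadjoint:
  "star x = x \<Longrightarrow> norm (x * x) = (norm (x::'a::cstar_algebra))\<^sup>2"
  using cstar_identity[of x] by simp

section \<open>Invertible elements and the Neumann series\<close>

definition invertible :: "'a::monoid_mult \<Rightarrow> bool" where
  "invertible x \<longleftrightarrow> (\<exists>y. x * y = 1 \<and> y * x = 1)"

text \<open>Commutation turns the inverse \<open>z\<close> of the product into a left inverse
  \<open>z * y\<close> and a right inverse \<open>y * z\<close> of \<open>x\<close>, which must
  agree.\<close>

lemma invertible_factor: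
  assumes "invertible (x * y)" and comm: "x * y = y * x"
  shows "invertible (x::'a::monoid_mult)"
proof -
  obtain z where z: "x * y * z = 1" "z * (x * y) = 1"
    using assms unfolding invertible_def by blast
  have "z * y * x = 1" using z(2) comm by (simp add: mult.assoc)
  moreover have "x * (y * z) = 1" using z(1) by (simp add: mult.assoc)
  ultimately have "z * y = y * z" by (metis mult.assoc mult_1 mult_1_right)
  then show ?thesis unfolding invertible_def
    using \<open>z * y * x = 1\<close> \<open>x * (y * z) = 1\<close> by metis
qed

lemma invertible_scaleR:
  assumes "invertible x" "r \<noteq> 0"
  shows "invertible (r *\<^sub>R (x::'a::real_algebra_1))"
proof -
  obtain y where "x * y = 1" "y * x = 1" using assms unfolding invertible_def by blast
  then show ?thesis using \<open>r \<noteq> 0\<close> unfolding invertible_def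
    by (intro exI[of _ "inverse r *\<^sub>R y"]) simp
qed

text \<open>The inverse is the Neumann series: dropping its first term amounts to multiplying it by
  \<open>x\<close> on either side.\<close>

lemma invertible_one_minus:
  assumes "norm x < 1"
  shows "invertible (1 - (x::'a::{banach,real_normed_algebra_1}))"
proof -
  have s: "summable (\<lambda>n. x ^ n)"
    using assms by (rule complete_algebra_summable_geometric)
  define y where "y = (\<Sum>n. x ^ n)"
  have "(\<Sum>n. x ^ Suc n) = y - 1"
    using suminf_split_head[OF s] by (simp add: y_def)
  moreover have "(\<Sum>n. x ^ Suc n) = x * y"
    using suminf_mult[OF s, of x] by (simp add: y_def)
  moreover have "(\<Sum>n. x ^ Suc n) = y * x"
    using suminf_mult2[OF s, of x] by (simp add: y_def power_commutes)
  ultimately have "(1 - x) * y = 1" "y * (1 - x) = 1" by (simp_all add: algebra_simps)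
  then show ?thesis unfolding invertible_def by blast
qed

lemma invertible_of_real_minus:
  assumes "norm x < r"
  shows "invertible (of_real r - (x::'a::{banach,real_normed_algebra_1}))"
proof -
  have r: "r > 0" using assms norm_ge_zero[of x] by linarith
  have "norm (inverse r *\<^sub>R x) < 1" using assms r by (simp add: field_simps)
  then have "invertible (r *\<^sub>R (1 - inverse r *\<^sub>R x))"
    using r by (intro invertible_scaleR invertible_one_minus) auto
  then show ?thesis using r by (simp add: algebra_simps of_real_def)
qed

subsection \<open>Square roots\<close>

text \<open>Writing the root of \<open>1 - d\<close> as \<open>1 - w\<close>, the element \<open>w\<close> is a fixed point of
  \<open>w \<mapsto> (d + w\<^sup>2) / 2\<close>. On the boundary \<open>norm d = 1\<close> this map is not a contraction, but its
  iterates are dominated by those for the number \<open>d = 1\<close>.\<close>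

fun sqrt_iter :: "'a::real_algebra_1 \<Rightarrow> nat \<Rightarrow> 'a" where
  "sqrt_iter d 0 = 0"
| "sqrt_iter d (Suc n) = (1/2) *\<^sub>R (d + sqrt_iter d n * sqrt_iter d n)"

lemma sqrt_iter_commute: "x * d = d * x \<Longrightarrow> x * sqrt_iter d n = sqrt_iter d n * x"
  by (induction n) (simp_all add: algebra_simps, metis mult.assoc)

lemma star_sqrt_iter:
  "star d = d \<Longrightarrow> star (sqrt_iter d n) = sqrt_iter (d::'a::{cstar_algebra,real_normed_algebra_1}) n"
  by (induction n) (simp_all add: star_add star_mult star_scaleR)

lemma sqrt_iter_one_bounds: "0 \<le> sqrt_iter (1::real) n \<and> sqrt_iter (1::real) n \<le> 1"
  by (induction n) (auto simp: mult_le_one)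

lemma norm_sqrt_iter_le:
  assumes "norm (d::'a::real_normed_algebra_1) \<le> 1"
  shows "norm (sqrt_iter d n) \<le> sqrt_iter (1::real) n"
proof (induction n)
  case (Suc n)
  have "norm (d + sqrt_iter d n * sqrt_iter d n) \<le> norm d + norm (sqrt_iter d n) * norm (sqrt_iter d n)"
    by (intro order_trans[OF norm_triangle_ineq] add_left_mono norm_mult_ineq)
  also have "\<dots> \<le> 1 + sqrt_iter 1 n * sqrt_iter (1::real) n"
    using Suc sqrt_iter_one_bounds[of n] assms by (intro add_mono mult_mono) auto
  finally show ?case by simp
qed simp

text \<open>Iterates commute, so each increment is half the product of the previous increment and
  the sum of the two iterates. Induction bounds the first factor, \<open>norm_sqrt_iter_le\<close>
  the second.\<close>

lemma norm_sqrt_iter_diff_le: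
  assumes "norm (d::'a::real_normed_algebra_1) \<le> 1"
  shows "norm (sqrt_iter d (Suc n) - sqrt_iter d n) \<le> sqrt_iter (1::real) (Suc n) - sqrt_iter 1 n"
proof (induction n)
  case (Suc n)
  let ?u = "sqrt_iter d (Suc n)" and ?v = "sqrt_iter d n"
  let ?r = "sqrt_iter (1::real) (Suc n)" and ?s = "sqrt_iter (1::real) n"
  have comm: "?u * ?v = ?v * ?u"
    by (intro sqrt_iter_commute sqrt_iter_commute[symmetric]) simp
  \<comment> \<open>Stated for an arbitrary algebra because it serves both \<open>d\<close> and the
    dominating scalar iteration.\<close>
  have half: "sqrt_iter e (Suc (Suc n)) - sqrt_iter e (Suc n) =
      (1/2) *\<^sub>R ((sqrt_iter e (Suc n) - sqrt_iter e n) * (sqrt_iter e (Suc n) + sqrt_iter e n))"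
    if "sqrt_iter e (Suc n) * sqrt_iter e n = sqrt_iter e n * sqrt_iter e (Suc n)"
    for e :: "'b::real_algebra_1"
  proof -
    have "x = (1/2) *\<^sub>R (e + y * y) \<Longrightarrow> y = (1/2) *\<^sub>R (e + z * z) \<Longrightarrow> y * z = z * y
      \<Longrightarrow> x - y = (1/2) *\<^sub>R ((y - z) * (y + z))" for x y z :: 'b
      by (simp only: scaleR_diff_right[symmetric]) (simp add: algebra_simps)
    from this[OF sqrt_iter.simps(2) sqrt_iter.simps(2) that] show ?thesis .
  qed
  have "norm (sqrt_iter d (Suc (Suc n)) - ?u) = norm ((1/2) *\<^sub>R ((?u - ?v) * (?u + ?v)))"
    by (simp only: half[OF comm])
  also have "\<dots> \<le> (1/2) * (norm (?u - ?v) * (norm ?u + norm ?v))"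
    by (simp del: sqrt_iter.simps)
       (intro order_trans[OF norm_mult_ineq] mult_left_mono norm_triangle_ineq norm_ge_zero)
  also have "\<dots> \<le> (1/2) * ((?r - ?s) * (?r + ?s))"
    using Suc order_trans[OF norm_ge_zero Suc] norm_sqrt_iter_le[OF assms, of n] norm_sqrt_iter_le[OF assms, of "Suc n"]
    by (intro mult_left_mono mult_mono add_mono) (auto intro: order_trans[OF norm_ge_zero] simp del: sqrt_iter.simps)
  also have "\<dots> = sqrt_iter 1 (Suc (Suc n)) - ?r"
    by (subst half) (simp_all only: mult.commute real_scaleR_def)
  finally show ?case .
qed (use assms in simp)

text \<open>The scalar iterates increase and are bounded by 1, so their increments are summable; by
  domination the iterates for \<open>d\<close> converge. Self-adjointness, commutation and the
  recursion pass to the limit.\<close>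

lemma sqrt_one_minus_ex:
  fixes d :: "'a::{cstar_algebra,real_normed_algebra_1}"
  assumes d: "norm d \<le> 1" "star d = d"
  obtains w where "norm w \<le> 1" "star w = w" "(1 - w) * (1 - w) = 1 - d"
    "\<And>x. x * d = d * x \<Longrightarrow> x * w = w * x"
proof -
  let ?w = "sqrt_iter d" and ?s = "sqrt_iter (1::real)"
  have inc: "incseq ?s"
    by (intro incseq_SucI) (metis norm_sqrt_iter_diff_le[OF d(1)] diff_ge_0_iff_ge norm_ge_zero order_trans)
  have "convergent ?s"
    using inc sqrt_iter_one_bounds by (intro Bseq_mono_convergent BseqI'[of _ 1]) (auto simp: incseq_def)
  then have "summable (\<lambda>n. ?s (Suc n) - ?s n)"
    by (metis telescope_summable convergent_def)
  then have "summable (\<lambda>n. ?w (Suc n) - ?w n)"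
    by (rule summable_comparison_test'[where N = 0]) (rule norm_sqrt_iter_diff_le[OF d(1)])
  then have "convergent ?w" 
    unfolding summable_iff_convergent sum_lessThan_telescope by simp
  then obtain w where w: "?w \<longlonglongrightarrow> w" by (auto simp: convergent_def)
  have w': "(\<lambda>n. ?w (Suc n)) \<longlonglongrightarrow> w" using w by (rule LIMSEQ_Suc)
  show thesis
  proof
    show "norm w \<le> 1"
      using LIMSEQ_le_const2[OF tendsto_norm[OF w]] norm_sqrt_iter_le[OF d(1)] sqrt_iter_one_bounds
      by (meson order_trans)
    have "(\<lambda>n. star (?w n)) \<longlonglongrightarrow> star w"
      by (rule bounded_linear.tendsto[OF bounded_linear_star w])
    then show "star w = w" using w LIMSEQ_unique by (fastforce simp: star_sqrt_iter[OF d(2)])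
    have "(\<lambda>n. ?w (Suc n)) \<longlonglongrightarrow> (1/2) *\<^sub>R (d + w * w)"
      unfolding sqrt_iter.simps by (intro tendsto_intros w)
    then have "w = (1/2) *\<^sub>R (d + w * w)" using w' LIMSEQ_unique by blast
    then have "2 *\<^sub>R w = d + w * w"
      by (metis scaleR_scaleR field_sum_of_halves mult_2 nonzero_mult_div_cancel_left scaleR_one times_divide_eq_right mult.right_neutral zero_neq_numeral)
    then show "(1 - w) * (1 - w) = 1 - d" by (simp add: algebra_simps scaleR_2)
    show "x * w = w * x" if "x * d = d * x" for x
    proof -
      have "(\<lambda>n. x * ?w n) \<longlonglongrightarrow> x * w" "(\<lambda>n. ?w n * x) \<longlonglongrightarrow> w * x"
        by (intro tendsto_intros w)+
      then show ?thesis using LIMSEQ_unique by (simp add: sqrt_iter_commute[OF that])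
    qed
  qed
qed

subsection \<open>Positive elements of a unital algebra\<close>

text \<open>For self-adjoint \<open>x\<close> the norm condition places the spectrum between 0 and
  \<open>2 * r\<close>. In this form closure under sums is just the triangle inequality, with the
  radii added.\<close>

definition nonneg_elem :: "'a::{cstar_algebra,real_normed_algebra_1} \<Rightarrow> bool" where
  "nonneg_elem x \<longleftrightarrow> star x = x \<and> (\<exists>r. norm (of_real r - x) \<le> r)"

lemma nonneg_elem_add:
  assumes "nonneg_elem x" "nonneg_elem y"
  shows "nonneg_elem (x + y)"
proof -
  obtain r s where "norm (of_real r - x) \<le> r" "norm (of_real s - y) \<le> s"
    using assms unfolding nonneg_elem_def by blast
  then have "norm (of_real (r + s) - (x + y)) \<le> r + s"
    using norm_triangle_ineq[of "of_real r - x" "of_real s - y"] by (simp add: algebra_simps)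
  then show ?thesis using assms unfolding nonneg_elem_def by (metis star_add)
qed

lemma nonneg_elem_scaleR:
  assumes "nonneg_elem x" "t \<ge> 0"
  shows "nonneg_elem (t *\<^sub>R x)"
proof -
  obtain r where "norm (of_real r - x) \<le> r"
    using assms unfolding nonneg_elem_def by blast
  then have "norm (t *\<^sub>R (of_real r - x)) \<le> t * r"
    using assms(2) by (simp add: mult_left_mono)
  then have "norm (of_real (t * r) - t *\<^sub>R x) \<le> t * r"
    by (simp add: of_real_def algebra_simps)
  then show ?thesis using assms unfolding nonneg_elem_def by (metis star_scaleR)
qed

lemma nonneg_elem_of_real_minus:
  "star x = x \<Longrightarrow> norm x \<le> r \<Longrightarrow> nonneg_elem (of_real r - x)"
  unfolding nonneg_elem_def by (auto simp: star_diff intro!: exI[of _ r])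

text \<open>Rescaling turns \<open>x\<close> into \<open>1 - d\<close> with \<open>norm d\<close> at
  most 1. The root \<open>1 - w\<close> is nonnegative with radius 1 because \<open>norm w\<close>
  is at most 1, and it is scaled back by \<open>sqrt r\<close>.\<close>

lemma nonneg_elem_sqrt_ex:
  fixes x :: "'a::{cstar_algebra,real_normed_algebra_1}"
  assumes "nonneg_elem x"
  obtains y where "nonneg_elem y" "y * y = x" "\<And>z. z * x = x * z \<Longrightarrow> z * y = y * z"
proof -
  obtain r0 where r0: "star x = x" "norm (of_real r0 - x) \<le> r0"
    using assms unfolding nonneg_elem_def by blast
  \<comment> \<open>Adding 1 preserves the norm bound and makes the radius strictly positive, so
    that it can be divided by even if \<open>r0\<close> is 0.\<close>
  define r where "r = r0 + 1"
  have r: "r > 0" using order_trans[OF norm_ge_zero r0(2)] by (simp add: r_def)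
  have "norm (of_real r - x) \<le> r"
    using norm_triangle_ineq[of "of_real r0 - x" 1] r0(2) by (simp add: r_def algebra_simps)
  define d where "d = 1 - inverse r *\<^sub>R x"
  have "d = inverse r *\<^sub>R (of_real r - x)" using r by (simp add: d_def of_real_def algebra_simps)
  then have "norm d = norm (of_real r - x) / r" using r by (simp add: divide_inverse)
  then have "norm d \<le> 1" using r \<open>norm (of_real r - x) \<le> r\<close> by simp
  moreover have "star d = d" by (simp add: d_def star_diff star_scaleR r0)
  ultimately obtain w where w: "norm w \<le> 1" "star w = w" "(1 - w) * (1 - w) = 1 - d"
    "\<And>x. x * d = d * x \<Longrightarrow> x * w = w * x"
    using sqrt_one_minus_ex by blast
  show thesis
  proof
    show "nonneg_elem (sqrt r *\<^sub>R (1 - w))"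
      using w r nonneg_elem_of_real_minus[of w 1] by (intro nonneg_elem_scaleR) auto
    show "(sqrt r *\<^sub>R (1 - w)) * (sqrt r *\<^sub>R (1 - w)) = x"
    proof -
      have "(sqrt r *\<^sub>R (1 - w)) * (sqrt r *\<^sub>R (1 - w)) = r *\<^sub>R ((1 - w) * (1 - w))"
        using r by simp
      then show ?thesis using r by (simp only: w(3)) (simp add: d_def)
    qed
    show "z * (sqrt r *\<^sub>R (1 - w)) = (sqrt r *\<^sub>R (1 - w)) * z" if "z * x = x * z" for z
      using w(4)[of z] that by (simp add: d_def algebra_simps)
  qed
qed

text \<open>For commuting self-adjoint \<open>x\<close>, \<open>y\<close> one has \<open>u\<^sup>* u = x\<^sup>2 + y\<^sup>2\<close> with \<open>u = x + i y\<close>, and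
  \<open>x\<close> is the real part of \<open>u\<close>.\<close>

lemma norm_square_le_of_sum_squares:
  fixes x y :: "'a::cstar_algebra"
  assumes sa: "star x = x" "star y = y" and comm: "x * y = y * x"
  shows "norm (x * x) \<le> norm (x * x + y * y)"
proof -
  define u where "u = x + \<i> *\<^sub>C y"
  have su: "star u = x - \<i> *\<^sub>C y" by (simp add: u_def star_add star_scaleC sa)
  have "star u * u = x * x + y * y"
    unfolding su by (simp add: u_def algebra_simps mult_scaleC_left mult_scaleC_right comm)
  then have u: "(norm u)\<^sup>2 = norm (x * x + y * y)" by (metis cstar_identity)
  have "u + star u = 2 *\<^sub>R x" unfolding su by (simp add: u_def scaleR_2)
  then have "norm x \<le> norm u" using norm_triangle_ineq[of u "star u"] by simp
  then have "(norm x)\<^sup>2 \<le> (norm u)\<^sup>2" by (simp add: power_mono)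
  then show ?thesis by (simp add: u norm_square_selfadjoint[OF sa(1)])
qed

text \<open>With \<open>r\<close> the norm of \<open>a * a\<close>, a root \<open>z\<close> of
  \<open>r - a * a\<close> commutes with \<open>a\<close>. Hence \<open>norm (z * z)\<close> is at
  most the norm of \<open>z * z + a * a\<close>, which is the scalar \<open>r\<close>.\<close>

lemma nonneg_elem_square:
  fixes a :: "'a::{cstar_algebra,real_normed_algebra_1}"
  assumes a: "star a = a"
  shows "nonneg_elem (a * a)"
proof -
  define r where "r = norm (a * a)"
  have ra: "norm (a * a) \<le> r" by (simp add: r_def)
  have sa: "star (a * a) = a * a" by (simp add: star_mult a)
  obtain z where z: "nonneg_elem z" "z * z = of_real r - a * a"
      "\<And>x. x * (of_real r - a * a) = (of_real r - a * a) * x \<Longrightarrow> x * z = z * x"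
    using nonneg_elem_sqrt_ex[OF nonneg_elem_of_real_minus[OF sa ra]] by blast
  have "a * z = z * a" by (rule z(3)) (simp add: algebra_simps of_real_def)
  then have "norm (z * z) \<le> norm (z * z + a * a)"
    using z(1) a by (intro norm_square_le_of_sum_squares) (auto simp: nonneg_elem_def)
  then have "norm (of_real r - a * a) \<le> r" by (simp add: z(2)) (simp add: r_def)
  then show ?thesis using sa unfolding nonneg_elem_def by blast
qed

text \<open>With \<open>e\<close> the inverse of \<open>r - d\<close> and \<open>E \<ge> norm e\<close>, the element
  \<open>(r - d) (E - e) = E r - 1 - E d\<close> is a square commuting with a root of \<open>d\<close>, whence
  \<open>norm (E d) \<le> E r - 1\<close>.\<close>

lemma norm_less_if_invertible:
  fixes d :: "'a::{cstar_algebra,real_normed_algebra_1}"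
  assumes d: "nonneg_elem d" and inv: "invertible (of_real r - d)" and r: "norm d \<le> r"
  shows "norm d < r"
proof -
  have sd: "star d = d" using d by (simp add: nonneg_elem_def)
  obtain e where e: "(of_real r - d) * e = 1" "e * (of_real r - d) = 1"
    using inv unfolding invertible_def by blast
  have "star e * (of_real r - d) = 1"
    using arg_cong[OF e(1), of star] by (simp add: star_mult star_diff sd)
  then have se: "star e = e" using e by (metis mult.assoc mult_1 mult_1_right)
  have ed: "e * d = d * e" using e by (simp add: algebra_simps of_real_def)
  have r0: "r > 0"
  proof (rule ccontr)
    assume "\<not> r > 0"
    then have "norm d = 0" "r = 0" using r norm_ge_zero[of d] by linarith+
    then show False using e(1) by simp
  qed
  \<comment> \<open>The summand \<open>inverse r\<close> makes \<open>E\<close> positive and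
    \<open>E * r - 1\<close> nonnegative, so that this scalar is its own norm in the final
    estimate.\<close>
  define E where "E = norm e + inverse r"
  have E: "E > 0" "norm e \<le> E" "E * r \<ge> 1"
    using r0 by (simp_all add: E_def add_nonneg_pos distrib_right)
  obtain y where y: "nonneg_elem y" "y * y = d" "\<And>x. x * d = d * x \<Longrightarrow> x * y = y * x"
    using nonneg_elem_sqrt_ex[OF d] by blast
  obtain z where z: "nonneg_elem z" "z * z = of_real r - d"
      "\<And>x. x * (of_real r - d) = (of_real r - d) * x \<Longrightarrow> x * z = z * x"
    using nonneg_elem_sqrt_ex[OF nonneg_elem_of_real_minus[OF sd r]] by blast
  obtain g where g: "nonneg_elem g" "g * g = of_real E - e"
      "\<And>x. x * (of_real E - e) = (of_real E - e) * x \<Longrightarrow> x * g = g * x"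
    using nonneg_elem_sqrt_ex[OF nonneg_elem_of_real_minus[OF se E(2)]] by blast
  have ey: "y * e = e * y" using y(3)[OF ed] by simp
  have yz: "y * z = z * y" by (rule z(3)) (simp add: algebra_simps of_real_def y(2)[symmetric])
  have ez: "e * z = z * e" by (rule z(3)) (simp add: algebra_simps of_real_def ed)
  have zg: "z * g = g * z" by (rule g(3)) (simp add: algebra_simps of_real_def ez)
  have yg: "y * g = g * y" by (rule g(3)) (simp add: algebra_simps of_real_def ey)
  define v where "v = z * g"
  define Y where "Y = sqrt E *\<^sub>R y"
  have "v * v = (z * z) * (g * g)" unfolding v_def by (metis zg mult.assoc)
  also have "\<dots> = of_real (E * r - 1) - E *\<^sub>R d"
    using e(1) unfolding z(2) g(2) by (simp add: algebra_simps of_real_def)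
  finally have v: "v * v = of_real (E * r - 1) - E *\<^sub>R d" .
  have Y: "Y * Y = E *\<^sub>R d" using E by (simp add: Y_def y(2))
  have "norm (Y * Y) \<le> norm (Y * Y + v * v)"
  proof (rule norm_square_le_of_sum_squares)
    show "star Y = Y" using y(1) by (simp add: Y_def star_scaleR nonneg_elem_def)
    show "star v = v" using z(1) g(1) zg by (simp add: v_def star_mult nonneg_elem_def)
    have "y * (z * g) = z * g * y" using yz yg by (metis mult.assoc)
    then show "Y * v = v * Y" by (simp add: Y_def v_def)
  qed
  then have "E * norm d \<le> E * r - 1" using E unfolding Y v by (simp del: of_real_diff of_real_mult)
  then have "E * norm d < E * r" by simp
  then show ?thesis using E by simp
qed

text \<open>The element is \<open>r + t\<close> minus \<open>r - x\<close>, and the norm of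
  \<open>r - x\<close> is at most \<open>r\<close>, below \<open>r + t\<close>.\<close>

lemma invertible_nonneg_elem_add:
  assumes "nonneg_elem x" "t > 0"
  shows "invertible (x + of_real t)"
proof -
  obtain r where "norm (of_real r - x) \<le> r"
    using assms unfolding nonneg_elem_def by blast
  then have "invertible (of_real (r + t) - (of_real r - x))"
    using assms(2) by (intro invertible_of_real_minus) simp
  then show ?thesis by (simp add: algebra_simps)
qed

text \<open>An affine substitution moves \<open>z\<close> to the imaginary unit; then
  \<open>b - \<i>\<close> is a commuting factor of the invertible element
  \<open>b * b + 1\<close>.\<close>

lemma invertible_selfadjoint_minus_nonreal:
  fixes a :: "'a::{cstar_algebra,real_normed_algebra_1}"
  assumes a: "star a = a" and z: "Im z \<noteq> 0"
  shows "invertible (a - z *\<^sub>C 1)"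
proof -
  define b where "b = inverse (Im z) *\<^sub>R (a - of_real (Re z))"
  have "star b = b" by (simp add: b_def star_scaleR star_diff a)
  then have "invertible (b * b + of_real 1)"
    by (intro invertible_nonneg_elem_add nonneg_elem_square) auto
  moreover have "(b - \<i> *\<^sub>C 1) * (b + \<i> *\<^sub>C 1) = b * b + of_real 1"
    "(b + \<i> *\<^sub>C 1) * (b - \<i> *\<^sub>C 1) = b * b + of_real 1"
    by (simp_all add: algebra_simps mult_scaleC_left mult_scaleC_right)
  ultimately have "invertible (b - \<i> *\<^sub>C 1)"
    by (metis invertible_factor)
  then have "invertible (Im z *\<^sub>R (b - \<i> *\<^sub>C 1))" using z by (rule invertible_scaleR)
  moreover have "Im z *\<^sub>R (b - \<i> *\<^sub>C 1) = a - z *\<^sub>C 1"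
  proof -
    have "z *\<^sub>C (1::'a) = Re z *\<^sub>R 1 + Im z *\<^sub>R (\<i> *\<^sub>C 1)"
      by (subst complex_eq[of z]) (simp add: scaleC_add_left scaleC_of_real[symmetric] mult.commute)
    then show ?thesis using z by (simp add: b_def algebra_simps of_real_def)
  qed
  ultimately show ?thesis by simp
qed

lemma nonneg_elem_iff_spectrum:
  fixes a :: "'a::{cstar_algebra,real_normed_algebra_1}"
  assumes a: "star a = a"
  shows "nonneg_elem a \<longleftrightarrow> {z. \<not> invertible (a - z *\<^sub>C 1)} \<subseteq> of_real ` {0..}"
    (is "?L \<longleftrightarrow> ?R")
proof
  assume ?L
  have "z \<in> of_real ` {0..}" if z: "\<not> invertible (a - z *\<^sub>C 1)" for z
  proof -
    have "Im z = 0" using z invertible_selfadjoint_minus_nonreal[OF a] by blast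
    then have zr: "z = of_real (Re z)" by (simp add: complex_eq_iff)
    then have "a - z *\<^sub>C 1 = a + of_real (- Re z)"
      by (metis scaleC_of_real of_real_def of_real_minus diff_conv_add_uminus)
    then have "\<not> - Re z > 0" using z invertible_nonneg_elem_add[OF \<open>?L\<close>] by metis
    then show ?thesis using zr by (intro image_eqI[of _ _ "Re z"]) auto
  qed
  then show ?R by blast
next
  assume ?R
  define g where "g = of_real (norm a) - a"
  have "nonneg_elem g" unfolding g_def by (rule nonneg_elem_of_real_minus[OF a order_refl])
  \<comment> \<open>This puts \<open>norm a - norm g\<close> into the spectrum of \<open>a\<close>.
    That this number is nonnegative is the norm condition for \<open>a\<close> with radius
    \<open>norm a\<close>.\<close>
  then have "\<not> invertible (of_real (norm g) - g)"
    using norm_less_if_invertible by blast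
  moreover have "of_real (norm g) - g = a - (complex_of_real (norm a - norm g)) *\<^sub>C 1"
    by (simp only: scaleC_of_real) (simp add: g_def of_real_def algebra_simps)
  ultimately have "complex_of_real (norm a - norm g) \<in> of_real ` {0..}"
    using \<open>?R\<close> by (metis (mono_tags, lifting) mem_Collect_eq subsetD)
  then have "norm g \<le> norm a" by (simp only: image_iff of_real_eq_iff) simp
  then show ?L using a unfolding nonneg_elem_def g_def by blast
qed

section \<open>Monotonicity of the norm, orthogonal elements and the Jordan decomposition\<close>

lemma norm_mono_nonneg_elem:
  assumes x: "nonneg_elem x" and y: "nonneg_elem y"
  shows "norm x \<le> norm (x + y)"
proof (rule ccontr)
  assume lt: "\<not> ?thesis"
  let ?m = "norm (x + y)"
  have "star (x + y) = x + y" using x y by (simp add: nonneg_elem_def star_add)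
  \<comment> \<open>This element is \<open>?m - x\<close>. If \<open>?m < norm x\<close>, adding the
    positive scalar \<open>norm x - ?m\<close> makes \<open>norm x - x\<close> invertible, which
    \<open>norm_less_if_invertible\<close> forbids.\<close>
  then have "nonneg_elem (of_real ?m - (x + y) + y)"
    by (intro nonneg_elem_add y nonneg_elem_of_real_minus) auto
  then have "invertible (of_real ?m - (x + y) + y + of_real (norm x - ?m))"
    using lt by (intro invertible_nonneg_elem_add) auto
  then have "invertible (of_real (norm x) - x)" by (simp add: algebra_simps)
  then show False using norm_less_if_invertible[OF x] by blast
qed

text \<open>Orthogonality gives \<open>(p + t) * (q + t) = t * (p + q + t)\<close>, which is
  invertible for \<open>t > 0\<close>; hence so is its commuting factor \<open>p + t\<close>, and
  \<open>p\<close> has no negative spectrum.\<close>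

lemma nonneg_elem_orthogonal_summand:
  assumes sa: "star p = p" and orth: "p * q = 0" "q * p = 0" and pq: "nonneg_elem (p + q)"
  shows "nonneg_elem p"
  unfolding nonneg_elem_iff_spectrum[OF sa]
proof safe
  fix z assume z: "\<not> invertible (p - z *\<^sub>C 1)"
  have "Im z = 0" using z invertible_selfadjoint_minus_nonreal[OF sa] by blast
  then have zr: "z = of_real (Re z)" by (simp add: complex_eq_iff)
  define t where "t = - Re z"
  have pz: "p - z *\<^sub>C 1 = p + of_real t"
    unfolding t_def by (metis zr scaleC_of_real of_real_def of_real_minus diff_conv_add_uminus)
  have "(p + of_real t) * (q + of_real t) = t *\<^sub>R (p + q + of_real t)"
    "(q + of_real t) * (p + of_real t) = t *\<^sub>R (p + q + of_real t)"
    by (simp_all add: algebra_simps of_real_def orth)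
  then have "invertible (p + of_real t)" if "t > 0"
    using invertible_factor[of "p + of_real t" "q + of_real t"] that
      invertible_scaleR[OF invertible_nonneg_elem_add[OF pq that], of t] by simp
  then have "Re z \<ge> 0" using z pz by (force simp: t_def)
  then show "z \<in> of_real ` {0..}" using zr by (intro image_eqI[of _ _ "Re z"]) auto
qed

text \<open>The square of \<open>x + y\<close> is \<open>x * x + y * y\<close>, again a sum of
  orthogonal self-adjoint elements. In the unit ball, repeated squaring bounds all powers of
  \<open>norm (x + y)\<close> with exponent \<open>2 ^ n\<close> by 2, so this norm cannot exceed 1.
  The general case follows by scaling.\<close>

lemma norm_orthogonal_add_le:
  fixes p q :: "'a::cstar_algebra"
  assumes sa: "star p = p" "star q = q" and orth: "p * q = 0" "q * p = 0"
    and r: "norm p \<le> r" "norm q \<le> r"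
  shows "norm (p + q) \<le> r"
proof -
  have pow: "norm (x + y) ^ 2 ^ n \<le> 2"
    if "star x = x" "star y = y" "x * y = 0" "y * x = 0" "norm x \<le> 1" "norm y \<le> 1"
    for x y :: 'a and n
    using that
  proof (induction n arbitrary: x y)
    case 0
    then show ?case using norm_triangle_ineq[of x y] by simp
  next
    case (Suc n)
    have "star (x + y) = x + y" using Suc.prems by (simp add: star_add)
    then have "(norm (x + y))\<^sup>2 = norm (x * x + y * y)"
      using norm_square_selfadjoint[of "x + y"] Suc.prems by (simp add: algebra_simps)
    moreover have "norm (x * x + y * y) ^ 2 ^ n \<le> 2"
    proof (rule Suc.IH)
      have "x * x * (y * y) = x * (x * y) * y" "y * y * (x * x) = y * (y * x) * x"
        by (simp_all only: mult.assoc)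
      then show "x * x * (y * y) = 0" "y * y * (x * x) = 0"
        using Suc.prems by simp_all
    qed (use Suc.prems in \<open>simp_all add: star_mult norm_square_selfadjoint power_le_one\<close>)
    ultimately show ?case by (simp add: power_mult)
  qed
  have unit: "norm (x + y) \<le> 1"
    if "star x = x" "star y = y" "x * y = 0" "y * x = 0" "norm x \<le> 1" "norm y \<le> 1" for x y :: 'a
  proof (rule ccontr)
    assume gt: "\<not> ?thesis"
    then obtain n where "2 < norm (x + y) ^ n" using real_arch_pow[of "norm (x + y)" 2] by auto
    also have "\<dots> \<le> norm (x + y) ^ 2 ^ n"
      using gt by (intro power_increasing) (auto intro: less_imp_le)
    finally show False using pow[OF that, of n] by simp
  qed
  show ?thesis
  proof (cases "r = 0")
    case False
    then have r0: "r > 0" using order_trans[OF norm_ge_zero r(1)] by simp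
    have "norm (inverse r *\<^sub>R p + inverse r *\<^sub>R q) \<le> 1"
      using r0 r by (intro unit) (simp_all add: star_scaleR sa orth field_simps)
    then have "inverse r * norm (p + q) \<le> 1" using r0 by (simp flip: scaleR_add_right)
    then show ?thesis using r0 by (simp add: field_simps)
  qed (use r in simp)
qed

text \<open>Here \<open>y\<close> is the absolute value of \<open>a\<close>, and \<open>p\<close>,
  \<open>q\<close> are the halves of \<open>y + a\<close> and \<open>y - a\<close>. They are
  orthogonal since \<open>y * y = a * a\<close>, and nonnegative as orthogonal summands of
  \<open>y\<close>.\<close>

lemma jordan_decomposition_unital:
  fixes a :: "'a::{cstar_algebra,real_normed_algebra_1}"
  assumes a: "star a = a"
  obtains p q where "nonneg_elem p" "nonneg_elem q" "a = p - q" "p * q = 0" "q * p = 0"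
proof -
  obtain y where y: "nonneg_elem y" "y * y = a * a" "\<And>z. z * (a * a) = a * a * z \<Longrightarrow> z * y = y * z"
    using nonneg_elem_sqrt_ex[OF nonneg_elem_square[OF a]] by blast
  have ay: "a * y = y * a" by (rule y(3)) (simp add: mult.assoc)
  define p where "p = (1/2) *\<^sub>R (y + a)"
  define q where "q = (1/2) *\<^sub>R (y - a)"
  have sum: "p + q = y" "q + p = y"
    by (simp_all add: p_def q_def algebra_simps flip: scaleR_add_left)
  have sy: "star y = y" using y(1) by (simp add: nonneg_elem_def)
  have sa: "star p = p" "star q = q"
    by (simp_all add: p_def q_def star_scaleR star_add star_diff a sy)
  have orth: "p * q = 0" "q * p = 0"
    by (simp_all add: p_def q_def algebra_simps ay y(2))
  show thesis
  proof
    show "nonneg_elem p" "nonneg_elem q"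
      using nonneg_elem_orthogonal_summand sa orth y(1) sum by metis+
    show "a = p - q" by (simp add: p_def q_def algebra_simps flip: scaleR_add_left)
  qed (simp_all add: orth)
qed

subsection \<open>The unitization as a unital C*-algebra\<close>

text \<open>A type constructor of its own, since class instances cannot single out the pairs with a
  complex second component.\<close>

datatype 'a unitization = Unitization (base: 'a) (scal: complex)

lemma unitization_eq_iff: "u = v \<longleftrightarrow> base u = base v \<and> scal u = scal v"
  by (auto intro: unitization.expand)

lemma scaleR_scaleC: "r *\<^sub>R (c *\<^sub>C x) = (complex_of_real r * c) *\<^sub>C (x::'a::cstar_algebra)"
  and scaleC_scaleR: "c *\<^sub>C (r *\<^sub>R x) = (complex_of_real r * c) *\<^sub>C x"
  by (simp_all flip: scaleC_of_real add: scaleC_scaleC mult.commute)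

text \<open>The action of the unitization on the algebra as an ideal; its operator norm enters the
  C*-norm below.\<close>

definition left_mult :: "'a::cstar_algebra unitization \<Rightarrow> 'a \<Rightarrow> 'a" where
  "left_mult u x = base u * x + scal u *\<^sub>C x"

instantiation unitization :: (cstar_algebra) ring_1
begin
definition "0 = Unitization 0 0"
definition "1 = Unitization 0 1"
definition "u + v = Unitization (base u + base v) (scal u + scal v)"
definition "u - v = Unitization (base u - base v) (scal u - scal v)"
definition "- u = Unitization (- base u) (- scal u)"
text \<open>Built on \<open>unitization_mult\<close> so that invertibility in this ring matches the
  definition of \<open>spectrum\<close>.\<close>

definition "u * v = (case unitization_mult (base u, scal u) (base v, scal v) of (x, c) \<Rightarrow> Unitization x c)"

lemma unitization_sel [simp]:
  "base (0::'a unitization) = 0" "scal (0::'a unitization) = 0"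
  "base (1::'a unitization) = 0" "scal (1::'a unitization) = 1"
  "base (u + v) = base u + base (v::'a unitization)" "scal (u + v) = scal u + scal v"
  "base (u - v) = base u - base v" "scal (u - v) = scal u - scal v"
  "base (- u) = - base u" "scal (- u) = - scal u"
  "base (u * v) = base u * base v + scal v *\<^sub>C base u + scal u *\<^sub>C base v"
  "scal (u * v) = scal u * scal v"
  by (simp_all add: zero_unitization_def one_unitization_def plus_unitization_def
      minus_unitization_def uminus_unitization_def times_unitization_def unitization_mult_def)

instance
  by standard (simp_all add: unitization_eq_iff algebra_simps mult_scaleC_left mult_scaleC_right)
end

instantiation unitization :: (cstar_algebra) real_vector
begin
definition "r *\<^sub>R u = Unitization (r *\<^sub>R base u) (r *\<^sub>R scal u)" for u :: "'a unitization"

lemma unitization_scaleR_sel [simp]: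
  "base (r *\<^sub>R u) = r *\<^sub>R base (u::'a unitization)" "scal (r *\<^sub>R u) = r *\<^sub>R scal u"
  by (simp_all add: scaleR_unitization_def)

instance
  by standard (simp_all add: unitization_eq_iff algebra_simps)
end

instantiation unitization :: (cstar_algebra) real_normed_algebra_1
begin
text \<open>If \<open>'a\<close> has a unit, the operator norm alone is only a seminorm.\<close>
definition "norm u = max (onorm (left_mult u)) (cmod (scal u))" for u :: "'a unitization"
definition "dist u v = norm (u - v)" for u v :: "'a unitization"
definition "sgn u = inverse (norm u) *\<^sub>R u" for u :: "'a unitization"
definition uniformity_unitization :: "('a unitization \<times> 'a unitization) filter" where
  "uniformity_unitization = (INF e\<in>{0<..}. principal {(x, y). dist x y < e})"
definition open_unitization :: "'a unitization set \<Rightarrow> bool" where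
  "open_unitization U \<longleftrightarrow> (\<forall>x\<in>U. eventually (\<lambda>(x', y). x' = x \<longrightarrow> y \<in> U) uniformity)"

lemma bounded_linear_left_mult: "bounded_linear (left_mult (u::'a unitization))"
proof (rule bounded_linear_intro[of _ "norm (base u) + cmod (scal u)"])
  show "left_mult u (r *\<^sub>R x) = r *\<^sub>R left_mult u x" for r x
    by (simp add: left_mult_def scaleR_add_right scaleR_scaleC scaleC_scaleR)
  show "norm (left_mult u x) \<le> norm x * (norm (base u) + cmod (scal u))" for x
  proof -
    have "norm (left_mult u x) \<le> norm (base u * x) + norm (scal u *\<^sub>C x)"
      unfolding left_mult_def by (rule norm_triangle_ineq)
    also have "\<dots> \<le> norm (base u) * norm x + cmod (scal u) * norm x"
      by (intro add_mono norm_mult_ineq) (simp add: norm_scaleC)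
    finally show ?thesis by (simp add: algebra_simps)
  qed
qed (simp add: left_mult_def algebra_simps)

lemma left_mult_add: "left_mult (u + v) = (\<lambda>x. left_mult u x + left_mult (v::'a unitization) x)"
  by (auto simp: left_mult_def algebra_simps)

lemma left_mult_mult: "left_mult (u * v) = left_mult u \<circ> left_mult (v::'a unitization)"
  by (auto simp: left_mult_def algebra_simps mult_scaleC_left mult_scaleC_right)

lemma left_mult_scaleR: "left_mult (r *\<^sub>R u) = (\<lambda>x. r *\<^sub>R left_mult (u::'a unitization) x)"
proof
  show "left_mult (r *\<^sub>R u) x = r *\<^sub>R left_mult u x" for x
    by (simp add: left_mult_def scaleR_add_right scaleR_scaleC scaleR_conv_of_real[where 'a = complex])
qed

text \<open>The vector \<open>star a\<close> attains the bound, by the C*-identity.\<close>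

lemma norm_le_onorm_left_mult: "norm a \<le> onorm (left_mult (Unitization (a::'a) 0))"
proof (cases "a = 0")
  case False
  have "norm (a * star a) = norm a * norm a"
    using cstar_identity[of "star a"] by (simp add: star_star power2_eq_square)
  then show ?thesis
    using False onorm[OF bounded_linear_left_mult, of "Unitization a 0" "star a"]
    by (simp add: left_mult_def)
qed (simp add: onorm_pos_le bounded_linear_left_mult)

lemma left_mult_zero: "left_mult (0::'a unitization) = (\<lambda>x. 0)"
  by (auto simp: left_mult_def)

text \<open>Subtract the scalar part from \<open>u\<close>: both operator norms involved are at most
  \<open>norm u\<close>. This yields definiteness of the norm and continuity of \<open>base\<close>,
  needed for completeness.\<close>

lemma norm_base_le: "norm (base u) \<le> norm (u::'a unitization) * 2"
proof -
  let ?c = "Unitization (0::'a) (- scal u)"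
  have "Unitization (base u) 0 = u + ?c" by (simp add: unitization_eq_iff)
  then have "norm (base u) \<le> onorm (left_mult u) + onorm (left_mult ?c)"
    using norm_le_onorm_left_mult[of "base u"]
      onorm_triangle[OF bounded_linear_left_mult[of u] bounded_linear_left_mult[of ?c]]
    by (simp add: left_mult_add)
  moreover have "onorm (left_mult ?c) \<le> cmod (scal u)"
    by (rule onorm_bound) (simp_all add: left_mult_def norm_scaleC)
  ultimately show ?thesis by (simp add: norm_unitization_def)
qed

instance
proof
  fix u v w :: "'a unitization" and r s :: real
  show "r *\<^sub>R u * v = r *\<^sub>R (u * v)" "u * r *\<^sub>R v = r *\<^sub>R (u * v)"
    by (simp_all add: unitization_eq_iff scaleR_add_right scaleR_scaleC
        scaleR_conv_of_real[where 'a = complex])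
       (simp_all add: scaleC_scaleR mult.commute)
  show "dist u v = norm (u - v)" "sgn u = u /\<^sub>R norm u"
    "(uniformity :: ('a unitization \<times> 'a unitization) filter) = (INF e\<in>{0<..}. principal {(x, y). dist x y < e})"
    by (simp_all only: dist_unitization_def sgn_unitization_def uniformity_unitization_def)
  show "open U \<longleftrightarrow> (\<forall>x\<in>U. \<forall>\<^sub>F (x', y) in uniformity. x' = x \<longrightarrow> y \<in> U)" for U :: "'a unitization set"
    by (simp only: open_unitization_def)
  show "norm u = 0 \<longleftrightarrow> u = 0"
  proof
    assume "norm u = 0"
    moreover from this have "cmod (scal u) \<le> 0"
      by (metis norm_unitization_def max.cobounded2)
    ultimately show "u = 0" using norm_base_le[of u] by (simp add: unitization_eq_iff)
  qed (simp add: norm_unitization_def left_mult_zero onorm_zero)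
  show "norm (u + v) \<le> norm u + norm v"
    using onorm_triangle[OF bounded_linear_left_mult[of u] bounded_linear_left_mult[of v]]
      norm_triangle_ineq[of "scal u" "scal v"]
    unfolding norm_unitization_def left_mult_add unitization_sel by linarith
  show "norm (r *\<^sub>R u) = \<bar>r\<bar> * norm u"
    by (simp add: norm_unitization_def left_mult_scaleR onorm_scaleR bounded_linear_left_mult
        max_mult_distrib_left)
  show "norm (u * v) \<le> norm u * norm v"
  proof -
    have "onorm (left_mult (u * v)) \<le> onorm (left_mult u) * onorm (left_mult v)"
      unfolding left_mult_mult by (intro onorm_compose bounded_linear_left_mult)
    also have "\<dots> \<le> norm u * norm v"
      by (intro mult_mono) (auto simp: norm_unitization_def le_max_iff_disj onorm_pos_le bounded_linear_left_mult)
    finally have "onorm (left_mult (u * v)) \<le> norm u * norm v" .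
    moreover have "cmod (scal (u * v)) \<le> norm u * norm v"
      unfolding unitization_sel norm_mult by (intro mult_mono) (auto simp: norm_unitization_def le_max_iff_disj)
    ultimately show ?thesis by (simp add: norm_unitization_def[of "u * v"])
  qed
  show "norm (1::'a unitization) = 1"
  proof -
    have "onorm (left_mult (1::'a unitization)) \<le> 1"
      by (rule onorm_bound) (simp_all add: left_mult_def)
    then show ?thesis by (simp add: norm_unitization_def)
  qed
qed
end

lemma bounded_linear_base: "bounded_linear (base :: 'a::cstar_algebra unitization \<Rightarrow> 'a)"
  by (rule bounded_linear_intro[of _ 2]) (simp_all add: norm_base_le)

lemma bounded_linear_scal: "bounded_linear (scal :: 'a::cstar_algebra unitization \<Rightarrow> complex)"
  by (rule bounded_linear_intro[of _ 1]) (simp_all add: norm_unitization_def)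

instantiation unitization :: (cstar_algebra) cstar_algebra
begin
definition "c *\<^sub>C u = Unitization (c *\<^sub>C base u) (c * scal u)" for u :: "'a unitization"
definition "star u = Unitization (star (base u)) (cnj (scal u))" for u :: "'a unitization"

lemma unitization_cstar_sel [simp]:
  "base (c *\<^sub>C u) = c *\<^sub>C base (u::'a unitization)" "scal (c *\<^sub>C u) = c * scal u"
  "base (star u) = star (base u)" "scal (star u) = cnj (scal u)"
  by (simp_all add: scaleC_unitization_def star_unitization_def)

text \<open>Apply the C*-identity in the algebra to \<open>left_mult u x\<close> and move
  \<open>u\<close> across by the involution.\<close>

lemma left_mult_norm_square: "(norm (left_mult u x))\<^sup>2 \<le> norm x * norm (left_mult (star u * u) (x::'a))"
proof -
  have "(norm (left_mult u x))\<^sup>2 = norm (star x * left_mult (star u * u) x)"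
    by (simp add: cstar_identity[symmetric] left_mult_def star_add star_mult star_scaleC
        algebra_simps mult_scaleC_left mult_scaleC_right)
  also have "\<dots> \<le> norm (star x) * norm (left_mult (star u * u) x)" by (rule norm_mult_ineq)
  finally show ?thesis by simp
qed

lemma onorm_left_mult_square: "(onorm (left_mult u))\<^sup>2 \<le> onorm (left_mult (star u * (u::'a unitization)))"
proof -
  let ?n = "onorm (left_mult (star u * u))"
  have n: "?n \<ge> 0" by (intro onorm_pos_le bounded_linear_left_mult)
  have "onorm (left_mult u) \<le> sqrt ?n"
  proof (rule onorm_bound)
    show "0 \<le> sqrt ?n" using n by simp
  next
    fix x
    have "(norm (left_mult u x))\<^sup>2 \<le> norm x * (?n * norm x)"
      using left_mult_norm_square[of u x] onorm[OF bounded_linear_left_mult, of "star u * u" x]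
      by (meson mult_left_mono norm_ge_zero order_trans)
    also have "\<dots> = (sqrt ?n * norm x)\<^sup>2" using n by (simp add: power2_eq_square)
    finally show "norm (left_mult u x) \<le> sqrt ?n * norm x"
      by (rule power2_le_imp_le) (use n in simp)
  qed
  then have "(onorm (left_mult u))\<^sup>2 \<le> (sqrt ?n)\<^sup>2"
    by (intro power_mono onorm_pos_le bounded_linear_left_mult)
  then show ?thesis using n by simp
qed

lemma norm_Unitization_le: "norm (Unitization (a::'a) c) \<le> norm a + cmod c"
proof -
  have "onorm (left_mult (Unitization a c)) \<le> norm a + cmod c"
  proof (rule onorm_bound)
    fix x
    have "norm (left_mult (Unitization a c) x) \<le> norm (a * x) + norm (c *\<^sub>C x)"
      by (simp add: left_mult_def norm_triangle_ineq)
    also have "\<dots> \<le> (norm a + cmod c) * norm x"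
      by (simp add: norm_mult_ineq norm_scaleC distrib_right)
    finally show "norm (left_mult (Unitization a c) x) \<le> (norm a + cmod c) * norm x" .
  qed simp
  then show ?thesis by (simp add: norm_unitization_def)
qed

instance
proof
  fix u v :: "'a unitization" and c d :: complex and r :: real
  show "c *\<^sub>C (u + v) = c *\<^sub>C u + c *\<^sub>C v" "(c + d) *\<^sub>C u = c *\<^sub>C u + d *\<^sub>C u"
    "c *\<^sub>C (d *\<^sub>C u) = (c * d) *\<^sub>C u" "complex_of_real r *\<^sub>C u = r *\<^sub>R u"
    "(c *\<^sub>C u) * v = c *\<^sub>C (u * v)" "u * (c *\<^sub>C v) = c *\<^sub>C (u * v)"
    by (simp_all add: unitization_eq_iff algebra_simps mult_scaleC_left mult_scaleC_right
        scaleC_of_real scaleR_conv_of_real[where 'a = complex])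
  show "star (star u) = u" "star (u + v) = star u + star v" "star (c *\<^sub>C u) = cnj c *\<^sub>C star u"
    "star (u * v) = star v * star u"
    by (simp_all add: unitization_eq_iff star_star star_add star_scaleC star_mult)
  show "norm (c *\<^sub>C u) = cmod c * norm u"
  proof -
    have le: "norm (c *\<^sub>C u) \<le> cmod c * norm u" for c and u :: "'a unitization"
    proof -
      have "onorm (left_mult (c *\<^sub>C u)) \<le> cmod c * onorm (left_mult u)"
      proof (rule onorm_bound)
        fix x
        have "left_mult (c *\<^sub>C u) x = c *\<^sub>C left_mult u x"
          by (simp add: left_mult_def mult_scaleC_left scaleC_add_right)
        then show "norm (left_mult (c *\<^sub>C u) x) \<le> cmod c * onorm (left_mult u) * norm x"
          using onorm[OF bounded_linear_left_mult, of u x]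
          by (simp add: norm_scaleC mult.assoc mult_left_mono)
      qed (simp add: onorm_pos_le bounded_linear_left_mult)
      then show ?thesis
        by (auto simp: norm_unitization_def norm_mult max_mult_distrib_left le_max_iff_disj)
    qed
    show ?thesis
    proof (cases "c = 0")
      case False
      \<comment> \<open>The reverse inequality is the bound \<open>le\<close> applied to the scalar
        \<open>inverse c\<close>.\<close>
      have "u = inverse c *\<^sub>C (c *\<^sub>C u)" using False by (simp add: unitization_eq_iff)
      then have "norm u \<le> inverse (cmod c) * norm (c *\<^sub>C u)"
        using le[of "inverse c" "c *\<^sub>C u"] by (simp add: norm_inverse)
      then show ?thesis using le[of c u] False by (simp add: field_simps)
    next
      case True
      then have "c *\<^sub>C u = 0" by (simp add: unitization_eq_iff)
      then show ?thesis using True by simp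
    qed
  qed
  show "norm (star u * u) = (norm u)\<^sup>2"
  proof (rule antisym)
    \<comment> \<open>Both entries of the maximum satisfy this inequality. Applied to
      \<open>star u\<close>, it also gives \<open>norm (star u) \<le> norm u\<close>, from which the
      opposite inequality follows.\<close>
    have sq: "(norm u)\<^sup>2 \<le> norm (star u * u)" for u :: "'a unitization"
      using onorm_left_mult_square[of u]
      by (auto simp: norm_unitization_def max_def norm_mult power2_eq_square)
    then show "(norm u)\<^sup>2 \<le> norm (star u * u)" .
    have "norm (star u) \<le> norm u"
    proof (cases "star u = 0")
      case False
      have ss: "star (star u) = u" by (simp add: unitization_eq_iff star_star)
      have "norm (star u) * norm (star u) \<le> norm u * norm (star u)"
        using sq[of "star u"] norm_mult_ineq[of u "star u"] by (simp add: ss power2_eq_square)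
      then show ?thesis using False by simp
    qed simp
    then show "norm (star u * u) \<le> (norm u)\<^sup>2"
      using norm_mult_ineq[of "star u" u] mult_right_mono[of "norm (star u)" "norm u" "norm u"]
      by (simp add: power2_eq_square)
  qed
next
  fix X :: "nat \<Rightarrow> 'a unitization"
  assume X: "Cauchy X"
  have "Cauchy (\<lambda>n. base (X n))"
    by (rule bounded_linear.Cauchy[OF bounded_linear_base X])
  then obtain a where a: "(\<lambda>n. base (X n)) \<longlonglongrightarrow> a"
    using Cauchy_convergent convergent_def by blast
  have "Cauchy (\<lambda>n. scal (X n))"
    by (rule bounded_linear.Cauchy[OF bounded_linear_scal X])
  then obtain c where c: "(\<lambda>n. scal (X n)) \<longlonglongrightarrow> c"
    using Cauchy_convergent convergent_def by blast
  \<comment> \<open>By \<open>norm_Unitization_le\<close> this sum dominates the distance to the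
    coordinatewise limit.\<close>
  have "(\<lambda>n. norm (base (X n) - a) + cmod (scal (X n) - c)) \<longlonglongrightarrow> 0"
    using tendsto_add[OF tendsto_norm[OF LIM_zero[OF a]] tendsto_norm[OF LIM_zero[OF c]]] by simp
  then have "X \<longlonglongrightarrow> Unitization a c"
  proof (rule metric_tendsto_imp_tendsto[OF _ always_eventually], intro allI)
    show "dist (X n) (Unitization a c) \<le> dist (norm (base (X n) - a) + cmod (scal (X n) - c)) 0" for n
      using norm_Unitization_le[of "base (X n) - a" "scal (X n) - c"]
      by (simp add: minus_unitization_def dist_norm)
  qed
  then show "convergent X" by (auto simp: convergent_def)
qed
end

subsection \<open>The positive cone\<close>

abbreviation embed :: "'a::cstar_algebra \<Rightarrow> 'a unitization" where
  "embed a \<equiv> Unitization a 0"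

lemma norm_embed: "norm (embed a) = norm a"
proof (rule antisym)
  show "norm (embed a) \<le> norm a" using norm_Unitization_le[of a 0] by simp
  show "norm a \<le> norm (embed a)"
    using norm_le_onorm_left_mult[of a] by (simp add: norm_unitization_def le_max_iff_disj)
qed

lemma spectrum_embed: "spectrum a = {z. \<not> invertible (embed a - z *\<^sub>C 1)}"
proof -
  have "(\<exists>u. unitization_mult (a, - z) u = (0, 1) \<and> unitization_mult u (a, - z) = (0, 1)) \<longleftrightarrow>
      invertible (embed a - z *\<^sub>C 1)" (is "?L \<longleftrightarrow> ?R") for z
  proof
    assume ?L
    then obtain y c where "unitization_mult (a, - z) (y, c) = (0, 1)"
      "unitization_mult (y, c) (a, - z) = (0, 1)" by (metis surj_pair)
    then show ?R unfolding invertible_def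
      by (intro exI[of _ "Unitization y c"]) (simp add: unitization_eq_iff unitization_mult_def)
  next
    assume ?R
    then obtain v where "(embed a - z *\<^sub>C 1) * v = 1" "v * (embed a - z *\<^sub>C 1) = 1"
      unfolding invertible_def by blast
    then show ?L
      by (intro exI[of _ "(base v, scal v)"]) (simp add: unitization_eq_iff unitization_mult_def)
  qed
  then show ?thesis by (simp add: spectrum_def)
qed

text \<open>The spectrum is defined in the unitization, so the unital criterion applies to
  \<open>embed a\<close>. All order facts are transferred through this equivalence.\<close>

lemma positive_cone_iff: "a \<in> positive_cone \<longleftrightarrow> nonneg_elem (embed a)"
proof (cases "star a = a")
  case True
  then have "star (embed a) = embed a" by (simp add: unitization_eq_iff)
  then show ?thesis using True
    by (simp add: positive_cone_def spectrum_embed nonneg_elem_iff_spectrum)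
next
  case False
  then show ?thesis by (simp add: positive_cone_def nonneg_elem_def unitization_eq_iff)
qed

lemma star_positive_cone: "a \<in> positive_cone \<Longrightarrow> star a = a"
  by (simp add: positive_cone_def)

lemma scaleR_positive_cone: "a \<in> positive_cone \<Longrightarrow> t \<ge> 0 \<Longrightarrow> t *\<^sub>R a \<in> positive_cone"
  using nonneg_elem_scaleR[of "embed a" t]
  by (simp add: positive_cone_iff scaleR_unitization_def)

lemma norm_mono_positive_cone:
  assumes "x \<in> positive_cone" "y - x \<in> positive_cone"
  shows "norm x \<le> norm y"
  using norm_mono_nonneg_elem[of "embed x" "embed (y - x)"] assms
  by (simp add: positive_cone_iff plus_unitization_def norm_embed)

lemma jordan_decomposition:
  fixes a :: "'a::cstar_algebra"
  assumes "star a = a"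
  obtains p q where "p \<in> positive_cone" "q \<in> positive_cone" "a = p - q" "p * q = 0" "q * p = 0"
proof -
  have "star (embed a) = embed a" using assms by (simp add: unitization_eq_iff)
  then obtain P Q where PQ: "nonneg_elem P" "nonneg_elem Q" "embed a = P - Q" "P * Q = 0" "Q * P = 0"
    using jordan_decomposition_unital by blast
  \<comment> \<open>The scalar parts agree because \<open>embed a\<close> has none, and their
    product vanishes by orthogonality. So both are 0, and the Jordan parts lie in the algebra
    itself.\<close>
  have "scal P = scal Q" "scal P * scal Q = 0"
    using PQ(3,4) by (simp_all add: unitization_eq_iff)
  then have P: "P = embed (base P)" and Q: "Q = embed (base Q)"
    by (simp_all add: unitization_eq_iff)
  show thesis
  proof
    show "base P \<in> positive_cone" "base Q \<in> positive_cone"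
      using PQ(1,2) P Q by (simp_all add: positive_cone_iff)
    show "a = base P - base Q" using PQ(3) by (simp add: unitization_eq_iff)
    show "base P * base Q = 0" "base Q * base P = 0"
      using arg_cong[OF PQ(4), of base] arg_cong[OF PQ(5), of base] P Q by (metis
          unitization_sel(1,11) unitization.sel scaleC.scale_zero_left add_0_right)+
  qed
qed

lemma cartesian_decomposition:
  fixes x :: "'a::cstar_algebra"
  obtains h k where "star h = h" "star k = k" "x = h + \<i> *\<^sub>C k"
proof
  let ?h = "(1/2) *\<^sub>R (x + star x)" and ?k = "(- \<i> / 2) *\<^sub>C (x - star x)"
  show "star ?h = ?h" by (simp add: star_scaleR star_add star_star add.commute)
  show "star ?k = ?k"
    by (simp add: star_scaleC star_diff star_star scaleC.scale_right_diff_distrib)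
  have "\<i> *\<^sub>C ?k = (1/2) *\<^sub>R (x - star x)"
    using scaleC_of_real[of "1/2" "x - star x"] by (simp add: scaleC_scaleC)
  then show "x = ?h + \<i> *\<^sub>C ?k" by (simp add: algebra_simps flip: scaleR_add_left)
qed

theorem theorem5p2:
  fixes T :: "'a::cstar_algebra \<Rightarrow> 'a"
  assumes "Vector_Spaces.linear scaleC scaleC T"
    and "positive_operator T"
    and "surj T"
    and "\<And>x. norm (T x) = norm x"
  shows "positive_operator (inv T)"
proof -
  interpret T: Vector_Spaces.linear scaleC scaleC T by (rule assms(1))
  have T_scaleR: "T (r *\<^sub>R x) = r *\<^sub>R T x" for r x
    by (metis T.scale scaleC_of_real)
  have T_pos: "T x \<in> positive_cone" if "x \<in> positive_cone" for x
    using assms(2) that by (auto simp: positive_operator_def)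
  have "inj T"
    unfolding T.inj_iff_eq_0 using assms(4) by (metis norm_eq_zero)
  have T_sa: "star (T h) = T h" if h: "star h = h" for h
  proof -
    obtain p q where "p \<in> positive_cone" "q \<in> positive_cone" "h = p - q"
      using jordan_decomposition[OF h] .
    then show ?thesis by (simp add: T.diff star_diff T_pos star_positive_cone)
  qed
  have T_star: "T (star x) = star (T x)" for x
  proof -
    obtain h k where hk: "star h = h" "star k = k" "x = h + \<i> *\<^sub>C k"
      by (rule cartesian_decomposition)
    from hk(1,2) show ?thesis
      unfolding hk(3)
      by (simp add: star_add star_scaleC T.add T.diff T.scale T_sa)
  qed
  \<comment> \<open>It suffices that \<open>T\<close> reflects the cone: by surjectivity
    \<open>T (inv T b) = b\<close>, so \<open>a\<close> may be taken to be \<open>inv T b\<close>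
    for positive \<open>b\<close>.\<close>
  have "a \<in> positive_cone" if Ta: "T a \<in> positive_cone" for a
  proof -
    have "T (star a) = T a" using star_positive_cone[OF Ta] by (simp add: T_star)
    then have "star a = a" using \<open>inj T\<close> by (simp add: inj_eq)
    then obtain p q where pq: "p \<in> positive_cone" "q \<in> positive_cone" "a = p - q"
      "p * q = 0" "q * p = 0"
      by (rule jordan_decomposition)
    have "q = 0"
    proof (rule ccontr)
      assume "q \<noteq> 0"
      define t where "t = norm p / norm q"
      have t: "t \<ge> 0" "t * norm q = norm p" using \<open>q \<noteq> 0\<close> by (simp_all add: t_def)
      have "norm ((1 + t) *\<^sub>R T q) \<le> norm (T p + t *\<^sub>R T q)"
      proof (rule norm_mono_positive_cone)
        show "(1 + t) *\<^sub>R T q \<in> positive_cone"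
          using t by (intro scaleR_positive_cone T_pos pq) auto
        \<comment> \<open>The difference is \<open>T p - T q = T a\<close>, whatever
          \<open>t\<close> is.\<close>
        show "T p + t *\<^sub>R T q - (1 + t) *\<^sub>R T q \<in> positive_cone"
          using Ta by (simp add: pq(3) T.diff algebra_simps)
      qed
      also have "\<dots> = norm (p + t *\<^sub>R q)"
        using assms(4)[of "p + t *\<^sub>R q"] by (simp add: T.add T_scaleR)
      \<comment> \<open>The elements \<open>p\<close> and \<open>t *\<^sub>R q\<close> are
        orthogonal, and the choice of \<open>t\<close> gives them equal norm.\<close>
      also have "\<dots> \<le> norm p"
        using t pq by (intro norm_orthogonal_add_le) (simp_all add: star_scaleR star_positive_cone)
      \<comment> \<open>By isometry the left end of the chain is
        \<open>(1 + t) * norm q = norm q + norm p\<close>.\<close>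
      finally have "norm q \<le> 0" using t by (simp add: assms(4) distrib_right)
      then show False using \<open>q \<noteq> 0\<close> by simp
    qed
    then show ?thesis using pq by simp
  qed
  then show ?thesis
    using surj_f_inv_f[OF assms(3)] by (auto simp: positive_operator_def)
qed

end
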